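(* Let $p$ be a prime greater than $3$ and let $t\in D_p$. Then modulo $p$: \begin{align*} \sum_{k=0}^{\lfloor p/3\rfloor}C_k^{(2)}t^k&\equiv 3\left(\frac{p}{3}\right) w_{\lfloor p/3\rfloor}(1-27t/2),\\ \sum_{k=(p-1)/2}^{\lfloor 2p/3\rfloor}C_k^{(2)}t^k&\equiv -\left(\frac{p}{3}\right)\Bigl(w_{\lfloor 2p/3\rfloor}(1-27t/2)+w_{\lfloor p/3\rfloor}(1-27t/2)\Bigr),\\ \sum_{k=0}^{\lfloor p/3\rfloor}\binom{3k}{k} t^k&\equiv \left(\frac{p}{3}\right) w_{\lfloor p/3\rfloor}(27t/2-1),\\ \sum_{k=(p+1)/2}^{\lfloor 2p/3\rfloor}\binom{3k}{k} t^k&\equiv \frac{1}{3}\left(\frac{p}{3}\right)\Bigl(w_{\lfloor 2p/3\rfloor}(27t/2-1)-w_{\lfloor p/3\rfloor}(27t/2-1)\Bigr). \end{align*}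
   Context: $C_n^{(2)}=\frac{1}{2n+1}\binom{3n}{n}$ are the second-order Catalan numbers. The polynomials $w_n(x)$ are defined by $w_0(x)=1$, $w_1(x)=1+2x$, $w_{n+1}(x)=2xw_n(x)-w_{n-1}(x)$. $D_p$ is the set of rationals whose denominator is not divisible by $p$; congruences are in the usual sense. $\left(\frac{p}{3}\right)$ is the Legendre symbol. *)

theory Defs
  imports
    Complex_Main
    "HOL-Computational_Algebra.Polynomial"
    "HOL-Number_Theory.Number_Theory"
begin

definition catalan2 :: "nat \<Rightarrow> rat" where
  "catalan2 n = 1 / of_nat (2 * n + 1) * of_nat ((3 * n) choose n)"

fun w_poly :: "nat \<Rightarrow> rat poly" where
  "w_poly 0 = 1"
| "w_poly (Suc 0) = [:1, 2:]"
| "w_poly (Suc (Suc n)) = [:0, 2:] * w_poly (Suc n) - w_poly n"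

(* quotient_of yields the fraction in lowest terms *)
definition D_set :: "nat \<Rightarrow> rat set" where
  "D_set p = {r. \<not> int p dvd snd (quotient_of r)}"

(* For p prime, D_set p is a subring of the rationals; this is congruence modulo p in that ring. *)
definition D_cong :: "nat \<Rightarrow> rat \<Rightarrow> rat \<Rightarrow> bool" where
  "D_cong p a b \<longleftrightarrow>
     a \<in> D_set p \<and> b \<in> D_set p \<and> (\<exists>c \<in> D_set p. a - b = of_nat p * c)"

end

theory Submission
  imports Defs
begin

text \<open>The polynomials \<open>w\<^sub>n(1 - s/2)\<close> and \<open>(-1)\<^sup>n w\<^sub>n(s/2 - 1)\<close> have the explicit coefficients
  \<open>(2n+1)/(2k+1) \<cdot> C(n+k, 2k)\<close> and \<open>C(n+k, 2k)\<close> at \<open>(-s)\<^sup>k\<close>. Now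
  \<open>(2k)! C(n+k, 2k) = \<Prod>j=1..k. (n+j)(n+1-j)\<close> and
  \<open>(2k)! C(3k, k) = \<Prod>j=1..k. 3(3j-1)(3j-2)\<close>, and if \<open>3n \<equiv> -1\<close> or \<open>3n \<equiv> -2\<close> modulo \<open>p\<close>, then
  \<open>(-27)\<^sup>k\<close> times the first product is congruent to the second one. For \<open>2k < p\<close> the
  factorial can be cancelled at once. For \<open>n = \<lfloor>2p/3\<rfloor>\<close> and larger \<open>k\<close>
  both products contain exactly one factor divisible by \<open>p\<close>, namely \<open>3p\<close> in the
  first one and \<open>p\<close> in the second one; after cancelling \<open>p\<close> this leaves a ratio of \<open>3\<close>.\<close>

section \<open>Congruence of p-integral rationals\<close>

text \<open>The denominator in lowest terms divides every other denominator, so one representation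
  with denominator prime to \<open>p\<close> is enough. Closure under sums and products then needs
  no reduction of fractions.\<close>

lemma D_set_iff:
  assumes "prime p"
  shows "r \<in> D_set p \<longleftrightarrow> (\<exists>a b. \<not> int p dvd b \<and> r = of_int a / of_int b)"
proof
  assume "r \<in> D_set p"
  moreover obtain a b where ab: "quotient_of r = (a, b)" by fastforce
  ultimately show "\<exists>a b. \<not> int p dvd b \<and> r = of_int a / of_int b"
    using quotient_of_div[OF ab] by (auto simp: D_set_def)
next
  assume "\<exists>a b. \<not> int p dvd b \<and> r = of_int a / of_int b"
  then obtain a b where ab: "\<not> int p dvd b" "r = of_int a / of_int b" by blast
  obtain c d where cd: "quotient_of r = (c, d)" by fastforce
  have d: "d > 0" "coprime c d" "r = of_int c / of_int d"
    using quotient_of_denom_pos[OF cd] quotient_of_coprime[OF cd] quotient_of_div[OF cd] by auto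
  have "b \<noteq> 0" using ab by auto
  then have "(of_int (a * d) :: rat) = of_int (c * b)"
    using ab d by (simp add: field_simps)
  then have "a * d = c * b" by linarith
  then have "d dvd c * b" by (metis dvd_triv_right)
  then have "d dvd b" using d coprime_commute coprime_dvd_mult_right_iff by blast
  then show "r \<in> D_set p" using ab cd dvd_trans by (auto simp: D_set_def)
qed

lemma D_set_of_int: "prime p \<Longrightarrow> of_int a \<in> D_set p"
  by (auto simp: D_set_def prime_gt_1_nat)

lemma D_set_mult:
  assumes "prime p" "x \<in> D_set p" "y \<in> D_set p"
  shows "x * y \<in> D_set p"
proof -
  obtain a b c d where *: "\<not> int p dvd b" "x = of_int a / of_int b"
    "\<not> int p dvd d" "y = of_int c / of_int d"
    using assms D_set_iff by meson
  then have "\<not> int p dvd b * d" using assms by (simp add: prime_dvd_mult_iff)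
  moreover have "x * y = of_int (a * c) / of_int (b * d)" using * by simp
  ultimately show ?thesis using D_set_iff assms(1) by blast
qed

lemma D_set_add:
  assumes "prime p" "x \<in> D_set p" "y \<in> D_set p"
  shows "x + y \<in> D_set p"
proof -
  obtain a b c d where *: "\<not> int p dvd b" "x = of_int a / of_int b"
    "\<not> int p dvd d" "y = of_int c / of_int d"
    using assms D_set_iff by meson
  then have "\<not> int p dvd b * d" using assms by (simp add: prime_dvd_mult_iff)
  moreover have "b \<noteq> 0" "d \<noteq> 0" using * by auto
  then have "x + y = of_int (a * d + c * b) / of_int (b * d)" using * by (simp add: field_simps)
  ultimately show ?thesis using D_set_iff assms(1) by blast
qed

lemma D_set_power: "prime p \<Longrightarrow> x \<in> D_set p \<Longrightarrow> x ^ k \<in> D_set p"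
  using D_set_of_int[of p 1] by (induction k) (auto intro: D_set_mult)

lemma D_set_sum:
  assumes "prime p" "\<And>k. k \<in> A \<Longrightarrow> f k \<in> D_set p"
  shows "sum f A \<in> D_set p"
  using assms(2) D_set_of_int[OF assms(1), of 0]
  by (induction A rule: infinite_finite_induct) (auto intro: D_set_add assms(1))

lemma D_cong_mult_left:
  assumes "prime p" "c \<in> D_set p" "D_cong p x y"
  shows "D_cong p (c * x) (c * y)"
proof -
  obtain d where d: "d \<in> D_set p" "x - y = of_nat p * d"
    using assms by (auto simp: D_cong_def)
  then have "c * x - c * y = of_nat p * (c * d)" by (simp add: algebra_simps)
  moreover have "c * d \<in> D_set p" "c * x \<in> D_set p" "c * y \<in> D_set p"
    using assms d by (auto intro: D_set_mult simp: D_cong_def)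
  ultimately show ?thesis unfolding D_cong_def by blast
qed

text \<open>Reduces a congruence between polynomial values at \<open>t\<close> to integer
  congruences between coefficients: the quotients of the coefficient differences by \<open>p\<close>
  give the required cofactor.\<close>

lemma D_cong_sum_power:
  assumes "prime p" "t \<in> D_set p" "\<And>k. k \<in> A \<Longrightarrow> [u k = v k] (mod int p)"
  shows "D_cong p (\<Sum>k\<in>A. of_int (u k) * t ^ k) (\<Sum>k\<in>A. of_int (v k) * t ^ k)"
proof -
  have in_D: "(\<Sum>k\<in>A. of_int (f k) * t ^ k) \<in> D_set p" for f :: "nat \<Rightarrow> int"
    using assms by (intro D_set_sum D_set_mult D_set_of_int D_set_power)
  have "of_int (u k) * t ^ k - of_int (v k) * t ^ k
        = of_nat p * (of_int ((u k - v k) div int p) * t ^ k)" if "k \<in> A" for k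
  proof -
    have "int p dvd u k - v k" using assms(3)[OF that] by (simp add: cong_iff_dvd_diff)
    then have "u k - v k = int p * ((u k - v k) div int p)" by simp
    then have "(of_int (u k - v k) :: rat) = of_nat p * of_int ((u k - v k) div int p)"
      by (metis of_int_mult of_int_of_nat_eq)
    then show ?thesis by (simp add: algebra_simps)
  qed
  then have "(\<Sum>k\<in>A. of_int (u k) * t ^ k) - (\<Sum>k\<in>A. of_int (v k) * t ^ k)
      = of_nat p * (\<Sum>k\<in>A. of_int ((u k - v k) div int p) * t ^ k)"
    by (simp add: sum_subtractf[symmetric] sum_distrib_left)
  then show ?thesis using in_D unfolding D_cong_def by (intro conjI bexI)
qed

section \<open>Explicit coefficients\<close>

text \<open>Division-free form of (2n+1)/(2k+1) C(n+k, 2k), so that coefficients can be compared as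
  integers.\<close>

definition w_coeff :: "nat \<Rightarrow> nat \<Rightarrow> int" where
  "w_coeff n k = int ((n + k) choose (2 * k)) + 2 * int ((n + k) choose (2 * k + 1))"

lemma w_coeff_eq_0: "n < k \<Longrightarrow> w_coeff n k = 0"
  by (simp add: w_coeff_def binomial_eq_0)

text \<open>Coefficient form of the recurrence of \<open>w_poly\<close> at 1 + x/2, where the
  multiplier is 2 + x. The vanishing hypotheses allow all three sums to be padded to the upper limit
  \<open>n + 2\<close>.\<close>

lemma sum_three_term_recurrence:
  fixes f g h :: "nat \<Rightarrow> 'a :: comm_ring_1"
  assumes "h 0 = 2 * g 0 - f 0"
    and "\<And>k. h (Suc k) = 2 * g (Suc k) + g k - f (Suc k)"
    and "f (n + 1) = 0" "f (n + 2) = 0" "g (n + 2) = 0"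
  shows "(\<Sum>k\<le>n + 2. h k * x ^ k) = (2 + x) * (\<Sum>k\<le>n + 1. g k * x ^ k) - (\<Sum>k\<le>n. f k * x ^ k)"
proof -
  have f: "(\<Sum>k\<le>n. f k * x ^ k) = (\<Sum>k\<le>n + 2. f k * x ^ k)"
    using assms by (simp add: numeral_2_eq_2)
  have g: "(\<Sum>k\<le>n + 1. g k * x ^ k) = (\<Sum>k\<le>n + 2. g k * x ^ k)"
    using assms by (simp add: numeral_2_eq_2)
  have xg: "x * (\<Sum>k\<le>n + 1. g k * x ^ k) = (\<Sum>k\<le>n + 1. g k * x ^ Suc k)"
    by (simp add: sum_distrib_left mult_ac del: sum.atMost_Suc)
  have split: "(\<Sum>k\<le>n + 2. q k) = q 0 + (\<Sum>k\<le>n + 1. q (Suc k))" for q :: "nat \<Rightarrow> 'a"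
    using sum.atMost_Suc_shift[of q "n + 1"] by simp
  have "(\<Sum>k\<le>n + 2. h k * x ^ k)
      = 2 * (\<Sum>k\<le>n + 2. g k * x ^ k) + (\<Sum>k\<le>n + 1. g k * x ^ Suc k) - (\<Sum>k\<le>n + 2. f k * x ^ k)"
    unfolding split assms(1,2)
    by (simp add: algebra_simps sum.distrib sum_subtractf sum_distrib_left del: sum.atMost_Suc)
  then show ?thesis unfolding f xg[symmetric] g[symmetric] by (simp add: algebra_simps)
qed

text \<open>Pascal's rule twice: each difference in the upper index lowers the lower index by
  one.\<close>

lemma binomial_second_difference:
  "int ((n + 2) choose (j + 2)) = 2 * int ((n + 1) choose (j + 2)) + int (n choose j) - int (n choose (j + 2))"
  by (simp add: numeral_2_eq_2)

text \<open>At s/2 - 1 the multiplier of the recurrence is -(2 - s). The factor (-1)^n absorbs the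
  sign, leaving the recurrence with 2 - s and initial values 1 and 1 - s.\<close>

lemma poly_w_poly_alternating:
  "poly (w_poly n) (s / 2 - 1) = (-1) ^ n * (\<Sum>k\<le>n. of_int (int ((n + k) choose (2 * k))) * (- s) ^ k)"
proof -
  define S where "S n = (\<Sum>k\<le>n. of_int (int ((n + k) choose (2 * k))) * (- s) ^ k)" for n
  have S: "S (n + 2) = (2 + - s) * S (n + 1) - S n" for n
    unfolding S_def
  proof (rule sum_three_term_recurrence)
    fix k
    show "of_int (int ((n + 2 + Suc k) choose (2 * Suc k))) =
        2 * of_int (int ((n + 1 + Suc k) choose (2 * Suc k)))
        + of_int (int ((n + 1 + k) choose (2 * k))) - (of_int (int ((n + Suc k) choose (2 * Suc k))) :: rat)"
      using arg_cong[OF binomial_second_difference[of "n + Suc k" "2 * k"], of "of_int :: int \<Rightarrow> rat"]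
      by (simp add: add_ac del: binomial_Suc_Suc)
  qed (auto simp: binomial_eq_0 simp del: binomial_Suc_Suc)
  have "poly (w_poly n) (s / 2 - 1) = (-1) ^ n * S n"
  proof (induction n rule: w_poly.induct)
    case (3 n)
    have "poly (w_poly (Suc (Suc n))) (s / 2 - 1) = (-1) ^ n * ((2 + - s) * S (n + 1) - S n)"
      using 3 by (simp add: algebra_simps)
    then show ?case unfolding S[symmetric] by simp
  qed (auto simp: S_def numeral_2_eq_2)
  then show ?thesis unfolding S_def .
qed

text \<open>At 1 - s/2 the multiplier is 2 - s. Both binomials in \<open>w_coeff\<close> satisfy the
  second-difference identity, one for even and one for odd lower index, hence so does their
  combination.\<close>

lemma poly_w_poly:
  "poly (w_poly n) (1 - s / 2) = (\<Sum>k\<le>n. of_int (w_coeff n k) * (- s) ^ k)"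
proof (induction n rule: w_poly.induct)
  case (3 n)
  have "(\<Sum>k\<le>n + 2. of_int (w_coeff (n + 2) k) * (- s) ^ k)
     = (2 + - s) * (\<Sum>k\<le>n + 1. of_int (w_coeff (n + 1) k) * (- s) ^ k)
     - (\<Sum>k\<le>n. of_int (w_coeff n k) * (- s) ^ k)"
  proof (rule sum_three_term_recurrence)
    fix k
    show "of_int (w_coeff (n + 2) (Suc k)) =
        2 * of_int (w_coeff (n + 1) (Suc k)) + of_int (w_coeff (n + 1) k)
        - (of_int (w_coeff n (Suc k)) :: rat)"
      using arg_cong[OF binomial_second_difference[of "n + Suc k" "2 * k"], of "of_int :: int \<Rightarrow> rat"]
        arg_cong[OF binomial_second_difference[of "n + Suc k" "2 * k + 1"], of "of_int :: int \<Rightarrow> rat"]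
      by (simp add: w_coeff_def add_ac del: binomial_Suc_Suc)
  qed (auto simp: w_coeff_eq_0 w_coeff_def[of _ 0])
  then show ?case using 3 by (simp add: algebra_simps del: sum.atMost_Suc)
qed (auto simp: w_coeff_def numeral_2_eq_2 numeral_3_eq_3)

text \<open>An integer expression for the second-order Catalan number. The case \<open>k = 0\<close>
  is separate because truncated \<open>k - 1\<close> would give C(0, 0) = 1 where C(0, -1) = 0 is
  meant.\<close>

definition catalan2_int :: "nat \<Rightarrow> int" where
  "catalan2_int k = int ((3 * k) choose k) - 2 * (if k = 0 then 0 else int ((3 * k) choose (k - 1)))"

text \<open>Follows from k C(3k, k) = (2k+1) C(3k, k-1), which turns the subtracted term into 2k
  C(3k, k).\<close>

lemma catalan2_int: "(2 * int k + 1) * catalan2_int k = int ((3 * k) choose k)"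
proof (cases k)
  case (Suc j)
  have "Suc j * ((3 * k) choose Suc j) = (3 * k - j) * ((3 * k) choose j)"
    using binomial_absorb_comp[of "3 * k" j] binomial_absorption[of j "3 * k"] by simp
  moreover have "3 * k - j = 2 * k + 1" using Suc by simp
  ultimately have "k * ((3 * k) choose k) = (2 * k + 1) * ((3 * k) choose j)"
    using Suc by metis
  then have "int k * int ((3 * k) choose k) = (2 * int k + 1) * int ((3 * k) choose j)"
    by (metis of_nat_mult of_nat_add of_nat_numeral of_nat_1)
  then show ?thesis using Suc by (simp add: catalan2_int_def algebra_simps)
qed (simp add: catalan2_int_def)

lemma catalan2_eq: "catalan2 k = of_int (catalan2_int k)"
proof -
  have "(of_int ((2 * int k + 1) * catalan2_int k) :: rat) = of_nat ((3 * k) choose k)"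
    unfolding catalan2_int by simp
  moreover have "(of_nat (2 * k + 1) :: rat) \<noteq> 0" by (simp only: of_nat_eq_0_iff)
  ultimately show ?thesis by (simp add: catalan2_def field_simps)
qed

text \<open>Absorption gives (2k+1) C(n+k, 2k+1) = (n-k) C(n+k, 2k), and (2k+1) + 2(n-k) = 2n+1. For
  k > n both sides vanish.\<close>

lemma w_coeff: "(2 * int k + 1) * w_coeff n k = (2 * int n + 1) * int ((n + k) choose (2 * k))"
proof (cases "k \<le> n")
  case True
  have "Suc (2 * k) * ((n + k) choose Suc (2 * k)) = (n + k - 2 * k) * ((n + k) choose (2 * k))"
    using binomial_absorb_comp[of "n + k" "2 * k"] binomial_absorption[of "2 * k" "n + k"] by simp
  then have "int (Suc (2 * k) * ((n + k) choose Suc (2 * k))) = int ((n - k) * ((n + k) choose (2 * k)))"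
    by simp
  then have "(2 * int k + 1) * int ((n + k) choose Suc (2 * k)) = (int n - int k) * int ((n + k) choose (2 * k))"
    using True by (simp add: of_nat_diff algebra_simps)
  then show ?thesis by (simp add: w_coeff_def algebra_simps)
qed (simp add: w_coeff_eq_0 binomial_eq_0)

section \<open>Coefficients as products\<close>

definition central_prod :: "nat \<Rightarrow> nat \<Rightarrow> int" where
  "central_prod n k = (\<Prod>j=1..k. (int n + int j) * (int n + 1 - int j))"

definition triple_prod :: "nat \<Rightarrow> int" where
  "triple_prod k = (\<Prod>j=1..k. 3 * (3 * int j - 1) * (3 * int j - 2))"

text \<open>The falling factorial from n+k down to n-k+1 is paired symmetrically about n + 1/2.
  Integer factors keep this valid for k > n, where the factor at j = n+1 is zero.\<close>

lemma fact_times_binomial_central: "fact (2 * k) * int ((n + k) choose (2 * k)) = central_prod n k"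
proof (induction k)
  case (Suc k)
  have "Suc (Suc (2*k)) * ((n + Suc k) choose Suc (Suc (2*k))) = (n + Suc k) * ((n + k) choose Suc (2*k))"
    using binomial_absorption[of "Suc (2*k)" "n + Suc k"] by simp
  moreover have double: "2 * Suc k = Suc (Suc (2 * k))" by simp
  ultimately have 1: "int (Suc (Suc (2 * k))) * int ((n + Suc k) choose (2 * Suc k))
      = int (n + Suc k) * int ((n + k) choose Suc (2*k))"
    unfolding double of_nat_mult[symmetric] by (simp only:)
  \<comment> \<open>Unfolding \<open>w_coeff\<close> and cancelling 2 recovers the absorption
    identity, without a case split on whether k exceeds n.\<close>
  have 2: "(2 * int k + 1) * int ((n + k) choose Suc (2*k)) = (int n - int k) * int ((n + k) choose (2*k))"
    using w_coeff[of k n] by (simp add: w_coeff_def algebra_simps)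
  have "fact (2 * Suc k) * int ((n + Suc k) choose (2 * Suc k))
      = fact (2 * k) * (2 * int k + 1) * (int (Suc (Suc (2 * k))) * int ((n + Suc k) choose (2 * Suc k)))"
    unfolding double fact_Suc by simp
  also have "\<dots> = int (n + Suc k) * fact (2 * k) * ((2 * int k + 1) * int ((n + k) choose Suc (2*k)))"
    unfolding 1 by (simp only: mult_ac)
  also have "\<dots> = int (n + Suc k) * (int n - int k) * (fact (2 * k) * int ((n + k) choose (2*k)))"
    unfolding 2 by (simp only: mult_ac)
  also have "\<dots> = central_prod n (Suc k)"
    unfolding Suc by (simp add: central_prod_def algebra_simps)
  finally show ?case .
qed (simp add: central_prod_def)

lemma fact_times_w_coeff: "fact (2 * k + 1) * w_coeff n k = (2 * int n + 1) * central_prod n k"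
proof -
  have "fact (2 * k + 1) * w_coeff n k = fact (2 * k) * ((2 * int k + 1) * w_coeff n k)"
    by (simp add: algebra_simps)
  then show ?thesis
    unfolding w_coeff fact_times_binomial_central[symmetric] by (simp only: mult_ac)
qed

text \<open>Grouping (3k)! into blocks 3j (3j-1) (3j-2) splits off k!, so
  \<open>triple_prod k\<close> is (3k)!/k!.\<close>

lemma fact_triple: "fact (3 * k) = fact k * triple_prod k"
proof (induction k)
  case (Suc k)
  have "3 * Suc k = Suc (Suc (Suc (3 * k)))" by simp
  then have "(fact (3 * Suc k) :: int) = (3 * int k + 3) * (3 * int k + 2) * (3 * int k + 1) * fact (3 * k)"
    by (simp only: fact_Suc) (simp add: algebra_simps)
  then show ?case unfolding Suc by (simp add: triple_prod_def algebra_simps)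
qed (simp add: triple_prod_def)

lemma fact_times_binomial_triple: "fact (2 * k) * int ((3 * k) choose k) = triple_prod k"
proof -
  have "fact k * fact (2 * k) * ((3 * k) choose k) = (fact (3 * k) :: nat)"
    using binomial_fact_lemma[of k "3 * k"] by simp
  then have "fact k * fact (2 * k) * int ((3 * k) choose k) = fact (3 * k)"
    by (metis of_nat_mult of_nat_fact)
  then show ?thesis unfolding fact_triple by simp
qed

lemma fact_times_catalan2_int: "fact (2 * k + 1) * catalan2_int k = triple_prod k"
proof -
  have "fact (2 * k + 1) * catalan2_int k = fact (2 * k) * ((2 * int k + 1) * catalan2_int k)"
    by (simp add: algebra_simps)
  then show ?thesis unfolding catalan2_int fact_times_binomial_triple .
qed

section \<open>Congruences between the coefficients\<close>

text \<open>Each factor -27 is spent as 3 times 3 times -3, so that only 3n occurs, whose residue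
  modulo \<open>p\<close> is known.\<close>

lemma central_prod_scaled:
  assumes "3 * int n = N"
  shows "(-27) ^ k * central_prod n k = (\<Prod>j=1..k. 3 * (3 * int j + N) * (3 * int j - 3 - N))"
  unfolding assms[symmetric] central_prod_def
  by (induction k) (simp_all add: algebra_simps)

text \<open>Passing from \<open>e = 1\<close> to \<open>e = 2\<close> merely swaps the last two
  factors; this treats both residues of \<open>p\<close> modulo 3 uniformly.\<close>

lemma triple_prod_reflect:
  assumes "e = 1 \<or> e = 2"
  shows "triple_prod k = (\<Prod>j=1..k. 3 * (3 * int j - e) * (3 * int j - 3 + e))"
  using assms unfolding triple_prod_def by (auto intro!: prod.cong simp: algebra_simps)

lemma shifted_factor_cong:
  "[3 * (x + (q * p - e)) * (x - 3 - (q * p - e)) = 3 * (x - e) * (x - 3 + e)] (mod p)" for p :: int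
proof -
  have "[x + (q * p - e) = x - e] (mod p)" "[x - 3 - (q * p - e) = x - 3 + e] (mod p)"
    by (simp_all add: cong_iff_dvd_diff)
  then show ?thesis by (intro cong_mult cong_refl)
qed

text \<open>Applied with \<open>q = 1\<close> for floor(p/3) and with \<open>q = 2\<close> for
  floor(2p/3).\<close>

lemma central_prod_cong:
  assumes "3 * int n = q * int p - e" "e = 1 \<or> e = 2"
  shows "[(-27) ^ k * central_prod n k = triple_prod k] (mod int p)"
  unfolding central_prod_scaled[OF assms(1)] triple_prod_reflect[OF assms(2)]
  by (intro cong_prod shifted_factor_cong)

text \<open>For such k both products are 0 modulo \<open>p\<close>, so the plain congruence carries
  no information; the index responsible is split off before comparing.\<close>

lemma central_prod_cong_quotient:
  assumes "3 * int m = 2 * int p - e" "e = 1 \<or> e = 2" "int p + e \<le> 3 * int k" "p > 1"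
  obtains U V where "triple_prod k = int p * U" "(-27) ^ k * central_prod m k = int p * V"
    "[V = 3 * U] (mod int p)"
proof -
  define f where "f j = 3 * (3 * int j + (2 * int p - e)) * (3 * int j - 3 - (2 * int p - e))" for j
  define g where "g j = 3 * (3 * int j - e) * (3 * int j - 3 + e)" for j
  have fg: "[f j = g j] (mod int p)" for j
    unfolding f_def g_def by (rule shifted_factor_cong)
  \<comment> \<open>This index satisfies 3i = p + e: the factor 3i - e of \<open>g i\<close> is
    \<open>p\<close>, while the factor 3i + 2p - e of \<open>f i\<close> is 3p. The bound on
    \<open>k\<close> ensures i \<le> k.\<close>
  define i where "i = p - m"
  have "m < p" using assms by linarith
  then have i: "3 * int i = int p + e" using assms(1) by (simp add: i_def of_nat_diff)
  then have "i \<in> {1..k}" using assms by auto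
  then have rem: "(\<Prod>j=1..k. h j) = h i * (\<Prod>j\<in>{1..k} - {i}. h j)" for h :: "nat \<Rightarrow> int"
    by (simp add: prod.remove)
  define P where "P h = (\<Prod>j\<in>{1..k} - {i}. h j)" for h :: "nat \<Rightarrow> int"
  have PP: "[P f = P g] (mod int p)" unfolding P_def by (intro cong_prod fg)
  define U where "U = 3 * (int p - 3 + 2 * e) * P g"
  define V where "V = 9 * (- int p - 3 + 2 * e) * P f"
  have "g i = int p * (3 * (int p - 3 + 2 * e))" unfolding g_def i by (simp add: algebra_simps)
  then have "triple_prod k = int p * U"
    unfolding triple_prod_reflect[OF assms(2)] g_def[symmetric] rem U_def P_def by simp
  moreover have "f i = int p * (9 * (- int p - 3 + 2 * e))" unfolding f_def i by (simp add: algebra_simps)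
  then have "(-27) ^ k * central_prod m k = int p * V"
    unfolding central_prod_scaled[OF assms(1)] f_def[symmetric] rem V_def P_def by simp
  \<comment> \<open>The remaining factors of \<open>f i\<close> and \<open>g i\<close> differ only
    in the sign of \<open>p\<close>, hence agree modulo \<open>p\<close>.\<close>
  moreover have "[V = 9 * (int p - 3 + 2 * e) * P g] (mod int p)"
    unfolding V_def using PP by (intro cong_mult cong_refl) (simp_all add: cong_iff_dvd_diff)
  then have "[V = 3 * U] (mod int p)" by (simp add: U_def mult_ac)
  ultimately show ?thesis using that by blast
qed

section \<open>Powers of p in factorials\<close>

lemma coprime_fact_less_prime:
  assumes "prime p" "N < p"
  shows "coprime (fact N :: int) (int p)"
proof -
  have "\<not> p dvd fact N" using assms prime_dvd_fact_iff[of p N] by simp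
  then have "coprime (fact N) p" using assms(1) prime_imp_coprime coprime_commute by blast
  then show ?thesis by (metis coprime_int_iff of_nat_fact)
qed

text \<open>The only multiple of \<open>p\<close> among 1, ..., N is \<open>p\<close>
  itself.\<close>

lemma fact_prime_cofactor:
  assumes "prime p" "p \<le> N" "N < 2 * p"
  shows "\<exists>u. (fact N :: int) = int p * u \<and> coprime u (int p)"
  using assms(2,3)
proof (induction N rule: dec_induct)
  case base
  have "(fact p :: int) = int p * fact (p - 1)"
    using assms(1) prime_gt_0_nat[of p] by (simp add: fact_reduce)
  moreover have "coprime (fact (p - 1) :: int) (int p)"
    using assms(1) prime_gt_0_nat[of p] by (intro coprime_fact_less_prime) auto
  ultimately show ?case by blast
next
  case (step N)
  then obtain u where u: "(fact N :: int) = int p * u" "coprime u (int p)" by auto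
  have "\<not> p dvd Suc N"
  proof
    assume "p dvd Suc N"
    then obtain c where c: "Suc N = p * c" by (auto elim: dvdE)
    have "p * c < p * 2" "p * 1 < p * c" unfolding c[symmetric] using step.hyps step.prems by auto
    then have "c < 2" "1 < c" by (simp_all only: mult_less_cancel1)
    then show False by simp
  qed
  then have "coprime (int (Suc N)) (int p)"
    using assms(1) prime_imp_coprime coprime_commute coprime_int_iff by blast
  then have "coprime (int (Suc N) * u) (int p)" using u by simp
  moreover have "(fact (Suc N) :: int) = int p * (int (Suc N) * u)" using u by simp
  ultimately show ?case by blast
qed

section \<open>Coefficient congruences for small and for large k\<close>

lemma binomial_cong_low:
  assumes "prime p" "3 * int n = q * int p - e" "e = 1 \<or> e = 2" "2 * k < p"
  shows "[(-27) ^ k * int ((n + k) choose (2 * k)) = int ((3 * k) choose k)] (mod int p)"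
proof -
  have "[fact (2 * k) * ((-27) ^ k * int ((n + k) choose (2 * k)))
       = fact (2 * k) * int ((3 * k) choose k)] (mod int p)"
    using central_prod_cong[OF assms(2,3), of k]
    unfolding fact_times_binomial_triple fact_times_binomial_central[symmetric]
    by (simp only: mult_ac)
  then show ?thesis
    using coprime_fact_less_prime[OF assms(1,4)] by (simp add: cong_mult_lcancel)
qed

text \<open>The sign comes from 3(2n+1) = 2qp + 3 - 2e. Here (2k+1)! is cancelled rather than (2k)!,
  hence the bound on \<open>2 * k + 1\<close>.\<close>

lemma w_coeff_cong_low:
  assumes "prime p" "3 * int n = q * int p - e" "e = 1 \<or> e = 2" "2 * k + 1 < p"
  shows "[3 * w_coeff n k * (-27) ^ k = (3 - 2 * e) * catalan2_int k] (mod int p)"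
proof -
  have "3 * (2 * int n + 1) - (3 - 2 * e) = int p * (2 * q)"
    using assms(2) by (simp add: algebra_simps)
  then have n: "[3 * (2 * int n + 1) = 3 - 2 * e] (mod int p)"
    unfolding cong_iff_dvd_diff by simp
  have "fact (2 * k + 1) * (3 * w_coeff n k * (-27) ^ k)
      = 3 * (2 * int n + 1) * ((-27) ^ k * central_prod n k)"
    using arg_cong[OF fact_times_w_coeff[of k n], of "\<lambda>x. 3 * (-27) ^ k * x"]
    by (simp only: mult_ac)
  also have "[\<dots> = (3 - 2 * e) * triple_prod k] (mod int p)"
    by (rule cong_mult[OF n central_prod_cong[OF assms(2,3)]])
  also have "(3 - 2 * e) * triple_prod k = fact (2 * k + 1) * ((3 - 2 * e) * catalan2_int k)"
    unfolding fact_times_catalan2_int[symmetric] by (simp only: mult_ac)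
  finally show ?thesis
    using cong_mult_lcancel[OF coprime_fact_less_prime[OF assms(1,4)]] by blast
qed

text \<open>One factor \<open>p\<close> is cancelled from (2k)! and from both products; the cofactor
  of the factorial is then invertible modulo \<open>p\<close>.\<close>

lemma binomial_cong_high:
  assumes "prime p" "3 * int m = 2 * int p - e" "e = 1 \<or> e = 2" "p \<le> 2 * k" "k < p"
    "int p + e \<le> 3 * int k"
  shows "[(-27) ^ k * int ((m + k) choose (2 * k)) = 3 * int ((3 * k) choose k)] (mod int p)"
proof -
  have p: "p > 1" using assms(1) prime_gt_1_nat by blast
  obtain U V where UV: "triple_prod k = int p * U" "(-27) ^ k * central_prod m k = int p * V"
    "[V = 3 * U] (mod int p)"
    using central_prod_cong_quotient[OF assms(2,3,6) p] .
  obtain u where u: "(fact (2 * k) :: int) = int p * u" "coprime u (int p)"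
    using fact_prime_cofactor[of p "2 * k"] assms by auto
  have "int p * (u * ((-27) ^ k * int ((m + k) choose (2 * k)))) = int p * V"
    unfolding UV(2)[symmetric] fact_times_binomial_central[symmetric] u(1) by (simp only: mult_ac)
  then have "u * ((-27) ^ k * int ((m + k) choose (2 * k))) = V" using p by simp
  moreover have "int p * (u * int ((3 * k) choose k)) = int p * U"
    unfolding UV(1)[symmetric] fact_times_binomial_triple[symmetric] u(1) by (simp only: mult_ac)
  then have "u * int ((3 * k) choose k) = U" using p by simp
  ultimately have "[u * ((-27) ^ k * int ((m + k) choose (2 * k)))
      = u * (3 * int ((3 * k) choose k))] (mod int p)"
    using UV(3) by (metis mult.left_commute)
  then show ?thesis using cong_mult_lcancel[OF u(2)] by blast
qed

text \<open>The ratio 3 between \<open>V\<close> and \<open>U\<close> supplies the 3 in 3(2m+1),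
  which is congruent to 3 - 2e. This is why the factor 3 of the case of small k is absent.\<close>

lemma w_coeff_cong_high:
  assumes "prime p" "3 * int m = 2 * int p - e" "e = 1 \<or> e = 2" "p \<le> 2 * k + 1" "2 * k + 1 < 2 * p"
    "int p + e \<le> 3 * int k"
  shows "[w_coeff m k * (-27) ^ k = (3 - 2 * e) * catalan2_int k] (mod int p)"
proof -
  have p: "p > 1" using assms(1) prime_gt_1_nat by blast
  obtain U V where UV: "triple_prod k = int p * U" "(-27) ^ k * central_prod m k = int p * V"
    "[V = 3 * U] (mod int p)"
    using central_prod_cong_quotient[OF assms(2,3,6) p] .
  obtain u where u: "(fact (2 * k + 1) :: int) = int p * u" "coprime u (int p)"
    using fact_prime_cofactor[of p "2 * k + 1"] assms by blast
  have "3 * (2 * int m + 1) - (3 - 2 * e) = int p * 4" using assms(2) by simp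
  then have m: "[3 * (2 * int m + 1) = 3 - 2 * e] (mod int p)"
    unfolding cong_iff_dvd_diff by simp
  have "int p * (u * (w_coeff m k * (-27) ^ k)) = fact (2 * k + 1) * w_coeff m k * (-27) ^ k"
    unfolding u(1) by (simp only: mult_ac)
  also have "\<dots> = (2 * int m + 1) * ((-27) ^ k * central_prod m k)"
    unfolding fact_times_w_coeff by (simp only: mult_ac)
  also have "\<dots> = int p * ((2 * int m + 1) * V)" unfolding UV(2) by (simp only: mult_ac)
  finally have "u * (w_coeff m k * (-27) ^ k) = (2 * int m + 1) * V" using p by simp
  also have "[\<dots> = (2 * int m + 1) * (3 * U)] (mod int p)"
    using UV(3) by (intro cong_mult cong_refl)
  also have "(2 * int m + 1) * (3 * U) = 3 * (2 * int m + 1) * U" by (simp only: mult_ac)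
  also have "[\<dots> = (3 - 2 * e) * U] (mod int p)"
    by (rule cong_mult[OF m cong_refl])
  also have "int p * (u * catalan2_int k) = int p * U"
    unfolding UV(1)[symmetric] fact_times_catalan2_int[symmetric] u(1) by (simp only: mult_ac)
  then have "U = u * catalan2_int k" using p by simp
  also have "(3 - 2 * e) * (u * catalan2_int k) = u * ((3 - 2 * e) * catalan2_int k)"
    by (simp only: mult_ac)
  finally show ?thesis using cong_mult_lcancel[OF u(2)] by blast
qed

text \<open>The squares modulo 3 are 0 and 1. The form 3 - 2e matches the sign in the coefficient
  congruences.\<close>

lemma Legendre_3_eq:
  assumes "p mod 3 = e" "e = 1 \<or> e = 2"
  shows "Legendre (int p) 3 = 3 - 2 * int e"
proof -
  have p: "int p mod 3 = int e" using assms(1) by (metis zmod_int of_nat_numeral)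
  have "QuadRes 3 (int p) \<longleftrightarrow> e = 1"
  proof
    assume "e = 1"
    then have "[1\<^sup>2 = int p] (mod 3)" using p by (simp add: cong_def)
    then show "QuadRes 3 (int p)" unfolding QuadRes_def by blast
  next
    assume "QuadRes 3 (int p)"
    then obtain y where y: "y\<^sup>2 mod 3 = int e" using p by (auto simp: QuadRes_def cong_def)
    have "y mod 3 = 0 \<or> y mod 3 = 1 \<or> y mod 3 = 2" by presburger
    moreover have "y\<^sup>2 mod 3 = (y mod 3)\<^sup>2 mod 3" by (simp add: power_mod)
    ultimately show "e = 1" using y assms(2) by auto
  qed
  then show ?thesis using assms(2) p by (auto simp: Legendre_def cong_def)
qed

theorem theorem11:
  fixes p :: nat and t :: rat
  assumes "prime p" and "p > 3" and "t \<in> D_set p"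
  shows "D_cong p (\<Sum>k = 0..p div 3. catalan2 k * t ^ k)
           (3 * of_int (Legendre (int p) 3) * poly (w_poly (p div 3)) (1 - 27 * t / 2))
    \<and> D_cong p (\<Sum>k = (p - 1) div 2..(2 * p) div 3. catalan2 k * t ^ k)
           (- of_int (Legendre (int p) 3) *
             (poly (w_poly ((2 * p) div 3)) (1 - 27 * t / 2) +
              poly (w_poly (p div 3)) (1 - 27 * t / 2)))
    \<and> D_cong p (\<Sum>k = 0..p div 3. of_nat ((3 * k) choose k) * t ^ k)
           (of_int (Legendre (int p) 3) * poly (w_poly (p div 3)) (27 * t / 2 - 1))
    \<and> D_cong p (\<Sum>k = (p + 1) div 2..(2 * p) div 3. of_nat ((3 * k) choose k) * t ^ k)
           (1 / 3 * of_int (Legendre (int p) 3) *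
             (poly (w_poly ((2 * p) div 3)) (27 * t / 2 - 1) -
              poly (w_poly (p div 3)) (27 * t / 2 - 1)))"
proof -
  note p = assms(1)
  define e where "e = p mod 3"
  define n where "n = p div 3"
  define m where "m = (2 * p) div 3"
  define L where "L = 3 - 2 * int e"
  have "\<not> 3 dvd p" using assms(1,2) primes_dvd_imp_eq[of 3 p] by auto
  then have e: "e = 1 \<or> e = 2" unfolding e_def by presburger
  have "\<not> int p dvd 3" using assms(2) zdvd_imp_le[of "int p" 3] by auto
  then have "coprime (int p) 3" using p by (intro prime_imp_coprime) auto
  have odd: "odd p" using assms(1,2) prime_odd_nat by auto
  have pn: "p = 3 * n + e" by (simp add: n_def e_def)
  have pm: "2 * p = 3 * m + (3 - e)" using e unfolding m_def e_def by presburger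
  have n: "3 * int n = 1 * int p - int e" using pn by simp
  have e': "3 - int e = 1 \<or> 3 - int e = 2" using e by auto
  \<comment> \<open>The residue attached to \<open>m\<close> is 3 - e, so its sign 3 - 2(3 - e) is
    -L.\<close>
  have m: "3 * int m = 2 * int p - (3 - int e)" using pm e by auto
  have Leg: "Legendre (int p) 3 = L" unfolding L_def using e by (intro Legendre_3_eq) (auto simp: e_def)
  have L2: "L * L = 1" using e by (auto simp: L_def)
  \<comment> \<open>As \<open>p\<close> is odd, \<open>n\<close> is even exactly if e = 1, and
    likewise \<open>m\<close>; so the powers of -1 in the alternating expansion both equal
    \<open>L\<close>.\<close>
  have sgn_n: "(-1 :: rat) ^ n = of_int L"
    using e odd pn by (auto simp: L_def)
  have "even m \<longleftrightarrow> e = 1" using e odd pm by auto presburger+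
  then have sgn_m: "(-1 :: rat) ^ m = of_int L"
    using e by (auto simp: L_def)
  have nm: "n \<le> m" "m < p" using pn pm e assms(2) by auto
  have extend: "(\<Sum>k\<le>n. of_int (f k) * x ^ k) = (\<Sum>k\<in>{0..m}. of_int (f k) * x ^ k)"
    if "\<forall>k>n. f k = 0" for f :: "nat \<Rightarrow> int" and x :: rat
    using nm that by (intro sum.mono_neutral_left) auto
  have zero: "\<forall>k>n. w_coeff n k = 0" "\<forall>k>n. int ((n + k) choose (2 * k)) = 0"
    by (simp_all add: w_coeff_eq_0 binomial_eq_0)
  \<comment> \<open>With zero coefficients below \<open>i\<close>, the partial sum can be compared
    termwise with a polynomial whose low coefficients vanish only modulo \<open>p\<close>.\<close>
  have truncate: "(\<Sum>k = i..m. of_int (f k) * t ^ k)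
      = (\<Sum>k\<in>{0..m}. of_int (if i \<le> k then f k else 0) * t ^ k)" for f i
    by (rule sum.mono_neutral_cong_left) auto
  have scale: "(- (27 * t)) ^ k = of_int ((-27) ^ k) * t ^ k" for k
    by (simp flip: power_mult_distrib)

  have "D_cong p (\<Sum>k\<in>{0..n}. of_int (catalan2_int k) * t ^ k)
      (\<Sum>k\<in>{0..n}. of_int (3 * L * w_coeff n k * (-27) ^ k) * t ^ k)"
  proof (rule D_cong_sum_power[OF p assms(3)])
    fix k assume "k \<in> {0..n}"
    then have "2 * k + 1 < p" using pn e assms(2) by auto
    from cong_mult[OF cong_refl[of L] w_coeff_cong_low[OF p n _ this]] e
    have "[L * (3 * w_coeff n k * (-27) ^ k) = L * L * catalan2_int k] (mod int p)"
      by (auto simp: L_def mult_ac)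
    then show "[catalan2_int k = 3 * L * w_coeff n k * (-27) ^ k] (mod int p)"
      unfolding L2 by (simp add: cong_sym_eq mult_ac)
  qed
  then have 1: "D_cong p (\<Sum>k = 0..n. catalan2 k * t ^ k)
      (3 * of_int L * poly (w_poly n) (1 - 27 * t / 2))"
    unfolding catalan2_eq poly_w_poly scale
    by (simp add: sum_distrib_left atMost_atLeast0 mult_ac)

  \<comment> \<open>From k = (p-1)/2 on, \<open>p\<close> divides (2k+1)!, the coefficient from
    \<open>n\<close> is zero and the one from \<open>m\<close> gives the Catalan number. Below, the
    two contributions have opposite signs and cancel.\<close>
  have "D_cong p (\<Sum>k\<in>{0..m}. of_int (if (p - 1) div 2 \<le> k then catalan2_int k else 0) * t ^ k)
      (\<Sum>k\<in>{0..m}. of_int (- L * (w_coeff m k + w_coeff n k) * (-27) ^ k) * t ^ k)"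
  proof (rule D_cong_sum_power[OF p assms(3)])
    fix k assume k: "k \<in> {0..m}"
    show "[(if (p - 1) div 2 \<le> k then catalan2_int k else 0)
        = - L * (w_coeff m k + w_coeff n k) * (-27) ^ k] (mod int p)"
    proof (cases "(p - 1) div 2 \<le> k")
      case True
      have k2: "p \<le> 2 * k + 1" using True odd by presburger
      have "n < k" using k2 pn e assms(2) by auto
      then have z: "w_coeff n k = 0" by (rule w_coeff_eq_0)
      have "2 * k + 1 < 2 * p" using k nm by auto
      \<comment> \<open>From k \<ge> n + 1 it follows that 3k \<ge> 3n + 3 = p + (3 - e).\<close>
      moreover have "int p + (3 - int e) \<le> 3 * int k"
        using \<open>n < k\<close> pn e by auto
      ultimately have "[w_coeff m k * (-27) ^ k = (3 - 2 * (3 - int e)) * catalan2_int k] (mod int p)"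
        using k nm k2 by (intro w_coeff_cong_high[OF p m e']) auto
      then have "[- L * (w_coeff m k * (-27) ^ k) = - L * ((3 - 2 * (3 - int e)) * catalan2_int k)] (mod int p)"
        by (rule cong_scalar_left)
      moreover have "- L * ((3 - 2 * (3 - int e)) * catalan2_int k) = L * L * catalan2_int k"
        by (simp add: L_def algebra_simps)
      ultimately show ?thesis using True z unfolding L2 by (simp add: cong_sym_eq mult_ac)
    next
      case False
      then have k2: "2 * k + 1 < p" by auto
      have "[3 * w_coeff m k * (-27) ^ k + 3 * w_coeff n k * (-27) ^ k
          = (3 - 2 * (3 - int e)) * catalan2_int k + (3 - 2 * int e) * catalan2_int k] (mod int p)"
        using e by (intro cong_add w_coeff_cong_low[OF p n _ k2] w_coeff_cong_low[OF p m e' k2]) auto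
      then have "[3 * ((w_coeff m k + w_coeff n k) * (-27) ^ k) = 3 * 0] (mod int p)"
        by (simp add: algebra_simps)
      then have "[(w_coeff m k + w_coeff n k) * (-27) ^ k = 0] (mod int p)"
        using cong_mult_lcancel \<open>coprime (int p) 3\<close> coprime_commute by blast
      from cong_mult[OF cong_refl[of "- L"] this] show ?thesis
        using False by (simp add: cong_sym_eq mult_ac)
    qed
  qed
  moreover have "(\<Sum>k\<in>{0..m}. of_int (- L * (w_coeff m k + w_coeff n k) * (-27) ^ k) * t ^ k)
      = - of_int L * (poly (w_poly m) (1 - 27 * t / 2) + poly (w_poly n) (1 - 27 * t / 2))"
    unfolding poly_w_poly extend[OF zero(1)]
    unfolding atMost_atLeast0 sum.distrib[symmetric] sum_distrib_left scale
    by (intro sum.cong refl) (simp add: algebra_simps)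
  ultimately have 2: "D_cong p (\<Sum>k = (p - 1) div 2..m. catalan2 k * t ^ k)
      (- of_int L * (poly (w_poly m) (1 - 27 * t / 2) + poly (w_poly n) (1 - 27 * t / 2)))"
    unfolding catalan2_eq truncate[symmetric] by (simp only:)

  have "D_cong p (\<Sum>k\<in>{0..n}. of_int (int ((3 * k) choose k)) * t ^ k)
      (\<Sum>k\<in>{0..n}. of_int ((-27) ^ k * int ((n + k) choose (2 * k))) * t ^ k)"
  proof (rule D_cong_sum_power[OF p assms(3)])
    fix k assume "k \<in> {0..n}"
    then have "2 * k < p" using pn e assms(2) by auto
    then show "[int ((3 * k) choose k) = (-27) ^ k * int ((n + k) choose (2 * k))] (mod int p)"
      using e by (intro cong_sym[OF binomial_cong_low[OF p n]]) auto
  qed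
  moreover have LL: "of_int L * (of_int L * x) = x" for x :: rat
    using L2 by (metis mult.assoc mult_1 of_int_1 of_int_mult)
  ultimately have 3: "D_cong p (\<Sum>k = 0..n. of_nat ((3 * k) choose k) * t ^ k)
      (of_int L * poly (w_poly n) (27 * t / 2 - 1))"
    unfolding poly_w_poly_alternating sgn_n scale LL
    by (simp add: atMost_atLeast0 mult_ac)

  \<comment> \<open>The claim is proved multiplied by 3, which keeps the coefficients integral; 1/3
    is restored afterwards as an element of \<open>D_set p\<close>. The split is at (p+1)/2 because
    only (2k)! is involved; below it both binomial coefficients have the same residue and their
    difference cancels.\<close>
  have "D_cong p (\<Sum>k\<in>{0..m}. of_int (if (p + 1) div 2 \<le> k then 3 * int ((3 * k) choose k) else 0) * t ^ k)
      (\<Sum>k\<in>{0..m}. of_int ((-27) ^ k * int ((m + k) choose (2 * k))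
          - (-27) ^ k * int ((n + k) choose (2 * k))) * t ^ k)"
  proof (rule D_cong_sum_power[OF p assms(3)])
    fix k assume k: "k \<in> {0..m}"
    show "[(if (p + 1) div 2 \<le> k then 3 * int ((3 * k) choose k) else 0)
        = (-27) ^ k * int ((m + k) choose (2 * k)) - (-27) ^ k * int ((n + k) choose (2 * k))] (mod int p)"
    proof (cases "(p + 1) div 2 \<le> k")
      case True
      have k2: "p \<le> 2 * k" using True odd by presburger
      have "n < k" using k2 pn e assms(2) by auto
      moreover have "int p + (3 - int e) \<le> 3 * int k"
        using \<open>n < k\<close> pn e by auto
      then have "[(-27) ^ k * int ((m + k) choose (2 * k)) = 3 * int ((3 * k) choose k)] (mod int p)"
        using k nm k2 by (intro binomial_cong_high[OF p m e']) auto
      ultimately show ?thesis using True by (simp add: cong_sym_eq binomial_eq_0)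
    next
      case False
      then have k2: "2 * k < p" by auto
      have "[(-27) ^ k * int ((m + k) choose (2 * k)) - (-27) ^ k * int ((n + k) choose (2 * k))
          = int ((3 * k) choose k) - int ((3 * k) choose k)] (mod int p)"
        using e by (intro cong_diff binomial_cong_low[OF p n _ k2] binomial_cong_low[OF p m e' k2]) auto
      then show ?thesis using False by (simp add: cong_sym_eq)
    qed
  qed
  moreover have "(1 / 3 :: rat) \<in> D_set p"
    unfolding D_set_iff[OF p] using \<open>\<not> int p dvd 3\<close> by (intro exI[of _ 1] exI[of _ 3]) auto
  ultimately have "D_cong p
      (1 / 3 * (\<Sum>k\<in>{0..m}. of_int (if (p + 1) div 2 \<le> k then 3 * int ((3 * k) choose k) else 0) * t ^ k))
      (1 / 3 * (\<Sum>k\<in>{0..m}. of_int ((-27) ^ k * int ((m + k) choose (2 * k))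
          - (-27) ^ k * int ((n + k) choose (2 * k))) * t ^ k))"
    using D_cong_mult_left[OF p] by blast
  moreover have "1 / 3 * (\<Sum>k\<in>{0..m}. of_int (if (p + 1) div 2 \<le> k then 3 * int ((3 * k) choose k) else 0) * t ^ k)
      = (\<Sum>k = (p + 1) div 2..m. of_nat ((3 * k) choose k) * t ^ k)"
    unfolding truncate[symmetric] by (simp add: sum_distrib_left)
  moreover have "(\<Sum>k\<in>{0..m}. of_int ((-27) ^ k * int ((m + k) choose (2 * k))
          - (-27) ^ k * int ((n + k) choose (2 * k))) * t ^ k)
      = of_int L * (poly (w_poly m) (27 * t / 2 - 1) - poly (w_poly n) (27 * t / 2 - 1))"
    unfolding poly_w_poly_alternating sgn_n sgn_m right_diff_distrib LL
    unfolding extend[OF zero(2)]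
    unfolding atMost_atLeast0 sum_subtractf[symmetric] scale
    by (intro sum.cong refl) (simp add: algebra_simps)
  ultimately have 4: "D_cong p (\<Sum>k = (p + 1) div 2..m. of_nat ((3 * k) choose k) * t ^ k)
      (1 / 3 * of_int L * (poly (w_poly m) (27 * t / 2 - 1) - poly (w_poly n) (27 * t / 2 - 1)))"
    by (simp only: mult.assoc)

  show ?thesis using 1 2 3 4 unfolding Leg n_def m_def by blast
qed

end
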